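(* Let $\delta>1$ and consider the Signed model $f(s)=\mathrm{sign}(s)$, so that $SY=|S|$ with $S\sim\mathcal{N}(0,1)$. Let $\sigma_{\rm opt}:=\min\{\sigma\ge0:\kappa(\sigma)=1/\delta\}$, $W_{\rm opt}:=\sigma_{\rm opt}G+SY$ with density $p_{W_{\rm opt}}$, $q(x)=x^2/2$, and $$\alpha_1=\frac{1-\sigma_{\rm opt}^2\mathcal{I}(W_{\rm opt})}{\delta\left(\sigma_{\rm opt}^2\mathcal{I}(W_{\rm opt})+\mathcal{I}(W_{\rm opt})-1\right)},\qquad \alpha_2=\frac{1}{\delta\left(\sigma_{\rm opt}^2\mathcal{I}(W_{\rm opt})+\mathcal{I}(W_{\rm opt})-1\right)}.$$ Then the function $\ell_{\rm opt}(w)=-\mathcal{M}_{\alpha_1q+\alpha_2\log(p_{W_{\rm opt}})}(w;1)$ is convex on $\mathbb{R}$.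
   Context: $G,S$ are i.i.d. $\mathcal{N}(0,1)$ and $Y=f(S)$. For a function $h$ and $\lambda>0$, $\mathcal{M}_h(x;\lambda)=\min_v\frac1{2\lambda}(x-v)^2+h(v)$ is the Moreau envelope. For a random variable $H$ with differentiable density $p_H$, $\mathcal{I}(H)=\mathbb{E}[(p_H'(H)/p_H(H))^2]$ is the Fisher information. For $\sigma>0$, $W_\sigma:=\sigma G+SY$ and $$\kappa(\sigma):=\frac{\sigma^2\left(\sigma^2\mathcal{I}(W_\sigma)+\mathcal{I}(W_\sigma)-1\right)}{1+\sigma^2\left(\sigma^2\mathcal{I}(W_\sigma)-1\right)},\qquad\kappa(0):=0.$$ *)

theory Defs
  imports "HOL-Probability.Probability"
begin

text \<open>The density of a random variable, normalised to be the differentiable one. The signs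
  and all points have to be pinned down, since \<^const>\<open>distributed\<close> only determines the
  density almost everywhere and \<^const>\<open>ennreal\<close> truncates negative values; the lemma below
  justifies the definite description.\<close>

definition is_diff_density :: "'a measure \<Rightarrow> ('a \<Rightarrow> real) \<Rightarrow> (real \<Rightarrow> real) \<Rightarrow> bool" where
  "is_diff_density M H p \<longleftrightarrow>
     (\<forall>x. 0 \<le> p x) \<and> (\<forall>x. p differentiable (at x)) \<and>
     distributed M lborel H (\<lambda>x. ennreal (p x))"

lemma is_diff_density_unique:
  assumes "prob_space M" "is_diff_density M H p" "is_diff_density M H p'"
  shows "p = p'"
proof -
  have dist: "distributed M lborel H (\<lambda>x. ennreal (p x))" "distributed M lborel H (\<lambda>x. ennreal (p' x))"
    and nonneg: "\<And>x. 0 \<le> p x" "\<And>x. 0 \<le> p' x"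
    and cont: "continuous_on UNIV p" "continuous_on UNIV p'"
    using assms unfolding is_diff_density_def
    by (auto simp: continuous_on_eq_continuous_at intro!: differentiable_imp_continuous_within)
  have "AE x in lborel. ennreal (p x) = ennreal (p' x)"
    using dist by (rule prob_space.distributed_unique[OF assms(1)])
  then have AE: "AE x in lborel. p x = p' x"
    using nonneg by simp
  define D where "D = {x. p x \<noteq> p' x}"
  have "open D"
    unfolding D_def using cont by (intro open_Collect_neq) auto
  moreover have "D \<in> null_sets lborel"
    using AE \<open>open D\<close> by (subst AE_iff_null_sets) (auto simp: D_def)
  then have "negligible D"
    by (simp add: negligible_iff_null_sets null_sets_completionI)
  ultimately have "D = {}"
    using open_not_negligible by blast
  then show ?thesis
    by (auto simp: D_def)
qed

definition diff_density :: "'a measure \<Rightarrow> ('a \<Rightarrow> real) \<Rightarrow> real \<Rightarrow> real" where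
  "diff_density M H = (THE p. is_diff_density M H p)"

definition fisher_information :: "'a measure \<Rightarrow> ('a \<Rightarrow> real) \<Rightarrow> real" where
  "fisher_information M H =
     (\<integral>\<omega>. (deriv (diff_density M H) (H \<omega>) / diff_density M H (H \<omega>))\<^sup>2 \<partial>M)"

text \<open>The envelope is taken in the extended reals because the infimum can be \<open>-\<infinity>\<close>:
  for the sign link function the law of \<open>S Y = \<bar>S\<bar>\<close> lives on the half line, and the
  objective whose envelope gives the optimal loss is unbounded below for \<open>x \<le> 0\<close>.\<close>

definition moreau_envelope :: "(real \<Rightarrow> real) \<Rightarrow> real \<Rightarrow> real \<Rightarrow> ereal" where
  "moreau_envelope h x l = (INF v. ereal (1 / (2 * l) * (x - v)\<^sup>2 + h v))"

text \<open>Convexity of extended-real-valued functions. In \<^typ>\<open>ereal\<close> one has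
  \<open>\<infinity> + -\<infinity> = \<infinity>\<close>, so this is the usual notion of a convex epigraph.\<close>

definition ereal_convex_on :: "'a::real_vector set \<Rightarrow> ('a \<Rightarrow> ereal) \<Rightarrow> bool" where
  "ereal_convex_on A f \<longleftrightarrow> convex A \<and>
     (\<forall>t x y. 0 < t \<longrightarrow> t < 1 \<longrightarrow> x \<in> A \<longrightarrow> y \<in> A \<longrightarrow>
        f (t *\<^sub>R x + (1 - t) *\<^sub>R y) \<le> ereal t * f x + ereal (1 - t) * f y)"

lemma ereal_convex_on_real: "ereal_convex_on A (\<lambda>x. ereal (f x)) \<longleftrightarrow> convex_on A f"
proof
  assume L: "ereal_convex_on A (\<lambda>x. ereal (f x))"
  have "f (t *\<^sub>R x + (1 - t) *\<^sub>R y) \<le> t * f x + (1 - t) * f y"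
    if "x \<in> A" "y \<in> A" "0 \<le> t \<and> t \<le> 1" for x y and t :: real
  proof (cases "t = 0 \<or> t = 1")
    case False
    then show ?thesis
      using L that unfolding ereal_convex_on_def by auto
  qed auto
  then show "convex_on A f"
    using L unfolding convex_on_alt ereal_convex_on_def by blast
next
  assume "convex_on A f"
  then show "ereal_convex_on A (\<lambda>x. ereal (f x))"
    unfolding convex_on_alt ereal_convex_on_def by simp
qed

definition W_var :: "('a \<Rightarrow> real) \<Rightarrow> ('a \<Rightarrow> real) \<Rightarrow> (real \<Rightarrow> real) \<Rightarrow> real \<Rightarrow> 'a \<Rightarrow> real" where
  "W_var G S f \<sigma> = (\<lambda>\<omega>. \<sigma> * G \<omega> + S \<omega> * f (S \<omega>))"

definition kappa :: "'a measure \<Rightarrow> ('a \<Rightarrow> real) \<Rightarrow> ('a \<Rightarrow> real) \<Rightarrow> (real \<Rightarrow> real) \<Rightarrow> real \<Rightarrow> real" where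
  "kappa M G S f \<sigma> =
     (if \<sigma> = 0 then 0 else
        let I = fisher_information M (W_var G S f \<sigma>)
        in \<sigma>\<^sup>2 * (\<sigma>\<^sup>2 * I + I - 1) / (1 + \<sigma>\<^sup>2 * (\<sigma>\<^sup>2 * I - 1)))"

definition sigma_opt :: "'a measure \<Rightarrow> ('a \<Rightarrow> real) \<Rightarrow> ('a \<Rightarrow> real) \<Rightarrow> (real \<Rightarrow> real) \<Rightarrow> real \<Rightarrow> real" where
  "sigma_opt M G S f \<delta> = (LEAST \<sigma>. 0 \<le> \<sigma> \<and> kappa M G S f \<sigma> = 1 / \<delta>)"

definition W_opt :: "'a measure \<Rightarrow> ('a \<Rightarrow> real) \<Rightarrow> ('a \<Rightarrow> real) \<Rightarrow> (real \<Rightarrow> real) \<Rightarrow> real \<Rightarrow> 'a \<Rightarrow> real" where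
  "W_opt M G S f \<delta> = W_var G S f (sigma_opt M G S f \<delta>)"

definition alpha1 :: "'a measure \<Rightarrow> ('a \<Rightarrow> real) \<Rightarrow> ('a \<Rightarrow> real) \<Rightarrow> (real \<Rightarrow> real) \<Rightarrow> real \<Rightarrow> real" where
  "alpha1 M G S f \<delta> =
     (let \<sigma> = sigma_opt M G S f \<delta>; I = fisher_information M (W_opt M G S f \<delta>)
      in (1 - \<sigma>\<^sup>2 * I) / (\<delta> * (\<sigma>\<^sup>2 * I + I - 1)))"

definition alpha2 :: "'a measure \<Rightarrow> ('a \<Rightarrow> real) \<Rightarrow> ('a \<Rightarrow> real) \<Rightarrow> (real \<Rightarrow> real) \<Rightarrow> real \<Rightarrow> real" where
  "alpha2 M G S f \<delta> =
     (let \<sigma> = sigma_opt M G S f \<delta>; I = fisher_information M (W_opt M G S f \<delta>)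
      in 1 / (\<delta> * (\<sigma>\<^sup>2 * I + I - 1)))"

definition ell_opt :: "'a measure \<Rightarrow> ('a \<Rightarrow> real) \<Rightarrow> ('a \<Rightarrow> real) \<Rightarrow> (real \<Rightarrow> real) \<Rightarrow> real \<Rightarrow> real \<Rightarrow> ereal" where
  "ell_opt M G S f \<delta> w =
     - moreau_envelope
         (\<lambda>v. alpha1 M G S f \<delta> * (v\<^sup>2 / 2)
            + alpha2 M G S f \<delta> * ln (diff_density M (W_opt M G S f \<delta>) v)) w 1"

end

theory Submission
  imports Defs "HOL-Real_Asymp.Real_Asymp"
begin

text \<open>
  Write \<open>\<tau> = 1 + \<sigma>\<^sup>2\<close>. For the sign function, \<open>S Y = \<bar>S\<bar>\<close>, and completing the square in the
  convolution of a Gaussian with a half normal law shows that for \<open>\<sigma> > 0\<close> the variable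
  \<open>W\<^sub>\<sigma> = \<sigma> G + \<bar>S\<bar>\<close> has the skew normal density
  \<open>p(w) = 2 n(w) Phi(c w)\<close>, where \<open>n\<close> is the centred normal density of variance \<open>\<tau>\<close>, \<open>Phi\<close> the
  standard normal distribution function and \<open>c = 1 / (\<sigma> sqrt \<tau>)\<close>
  (\<open>half_normal_convolution\<close>, \<open>diff_density_W\<close>).

  Let \<open>h = \<alpha>\<^sub>1 q + \<alpha>\<^sub>2 ln p\<close>. After the shift \<open>v = x + u\<close> the negated Moreau envelope of \<open>h\<close> is a
  supremum of translates of \<open>- h\<close> plus constants, so it is convex as soon as \<open>- h\<close> is
  (\<open>ereal_convex_on_minus_moreau_envelope\<close>). Up to a constant,
  \<open>- h(v) = (\<alpha>\<^sub>2/\<tau> - \<alpha>\<^sub>1) v\<^sup>2/2 - \<alpha>\<^sub>2 ln (Phi(c v))\<close>. Since \<open>Phi\<close> is log-concave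
  (\<open>log_concave_ineq\<close>), it suffices that \<open>\<alpha>\<^sub>2\<close> and \<open>\<alpha>\<^sub>2/\<tau> - \<alpha>\<^sub>1\<close> are nonnegative. Both follow
  from \<open>\<tau> I(W\<^sub>\<sigma>) \<ge> 1\<close>, a Cramer-Rao type inequality, which is visible in the explicit formula
  \<open>\<sigma>\<^sup>2 (\<tau> I(W\<^sub>\<sigma>) - 1) = A(\<sigma>)\<close>, where \<open>A(\<sigma>) = 2 \<sigma> \<integral> phi(\<sigma> x) phi(x)\<^sup>2 / Phi(x) dx\<close> and \<open>phi\<close> is
  the standard normal density (\<open>fisher_information_W\<close>).

  This argument applies to every \<open>\<sigma> > 0\<close>, so what remains is that \<open>\<sigma>\<^sub>o\<^sub>p\<^sub>t\<close> exists and is positive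
  (\<open>sigma_opt_pos\<close>). The formula above turns \<open>\<kappa>\<close> into
  \<open>(1 + \<sigma>\<^sup>2) A / (1 + \<sigma>\<^sup>2 A)\<close>, with \<open>A\<close> continuous on \<open>[0, \<infinity>)\<close>, zero at \<open>0\<close> and bounded away from
  \<open>0\<close> at infinity. Hence \<open>\<kappa>\<close> takes the value \<open>1/\<delta> < 1\<close>, and takes it first at a positive point.
\<close>

section \<open>The standard normal distribution function\<close>

abbreviation phi :: "real \<Rightarrow> real" where "phi \<equiv> std_normal_density"

definition Phi :: "real \<Rightarrow> real" where
  "Phi x = (\<integral>t. phi t * indicator {..x} t \<partial>lborel)"

lemma phi_pos: "0 < phi x"
  by (simp add: normal_density_pos)

lemma phi_cont: "continuous_on A phi"
  unfolding std_normal_density_def by (intro continuous_intros) auto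

lemma phi_minus: "phi (- x) = phi x"
  by (simp add: std_normal_density_def)

lemma phi_mono: "\<bar>x\<bar> \<le> \<bar>y\<bar> \<Longrightarrow> phi y \<le> phi x"
  by (auto simp: std_normal_density_def abs_le_square_iff intro!: divide_right_mono)

lemma phi_DERIV: "(phi has_real_derivative - x * phi x) (at x)"
  unfolding std_normal_density_def
  by (rule derivative_eq_intros refl | simp)+

lemma integrable_phi_indicator:
  "A \<in> sets borel \<Longrightarrow> integrable lborel (\<lambda>t. phi t * indicator A t)"
  by (rule integrable_real_mult_indicator) auto

lemma Phi_diff:
  assumes "a \<le> b"
  shows "Phi b - Phi a = integral {a..b} phi"
proof -
  have "Phi b - Phi a = (\<integral>t. phi t * indicator {..b} t - phi t * indicator {..a} t \<partial>lborel)"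
    unfolding Phi_def by (rule Bochner_Integration.integral_diff[symmetric])
      (auto intro: integrable_phi_indicator)
  also have "\<dots> = (\<integral>t. indicator {a..b} t *\<^sub>R phi t \<partial>lborel)"
  proof (rule integral_cong_AE)
    have "AE t in lborel. t \<noteq> a"
      by (rule AE_lborel_singleton)
    then show "AE t in lborel. phi t * indicator {..b} t - phi t * indicator {..a} t
        = indicator {a..b} t *\<^sub>R phi t"
      by eventually_elim (use assms in \<open>auto simp: indicator_def\<close>)
  qed auto
  also have "\<dots> = integral {a..b} phi"
    using integrable_phi_indicator[of "{a..b}"]
    by (subst set_lebesgue_integral_def[symmetric], intro set_borel_integral_eq_integral)
       (simp add: set_integrable_def mult.commute)
  finally show ?thesis .
qed

lemma Phi_DERIV: "(Phi has_real_derivative phi x) (at x)"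
proof -
  have "((\<lambda>y. integral {x - 1..y} phi) has_real_derivative phi x) (at x within {x - 1..x + 1})"
    by (rule integral_has_real_derivative) (auto intro: phi_cont)
  then have "((\<lambda>y. Phi (x - 1) + integral {x - 1..y} phi) has_real_derivative phi x)
      (at x within {x - 1..x + 1})"
    by (auto intro!: derivative_eq_intros)
  then have "((\<lambda>y. Phi (x - 1) + integral {x - 1..y} phi) has_real_derivative phi x) (at x)"
    by (simp add: at_within_Icc_at)
  then show ?thesis
  proof (rule DERIV_cong_ev[THEN iffD1, OF refl _ refl, rotated])
    have "eventually (\<lambda>y. y \<in> {x - 1<..<x + 1}) (nhds x)"
      by (rule eventually_nhds_in_open) auto
    then show "\<forall>\<^sub>F y in nhds x. Phi (x - 1) + integral {x - 1..y} phi = Phi y"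
    proof eventually_elim
      case (elim y)
      then show ?case using Phi_diff[of "x - 1" y] by simp
    qed
  qed
qed

lemma Phi_borel [measurable]: "Phi \<in> borel_measurable borel"
  by (intro borel_measurable_continuous_onI continuous_at_imp_continuous_on)
     (auto intro: DERIV_isCont Phi_DERIV)

lemma Phi_nonneg: "0 \<le> Phi x"
  unfolding Phi_def by (intro integral_nonneg_AE) auto

lemma Phi_le_1: "Phi x \<le> 1"
proof -
  have "Phi x \<le> (\<integral>t. phi t \<partial>lborel)"
    unfolding Phi_def
    by (intro integral_mono integrable_phi_indicator) (auto simp: indicator_def)
  then show ?thesis by simp
qed

text \<open>A crude lower bound, by the mass of the interval \<open>[x - 1, x]\<close>, on which the Gaussian density
  is smallest at an endpoint. It gives positivity of \<open>Phi\<close> and, in the left tail, an upper bound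
  on the ratio \<open>phi / Phi\<close> good enough for all integrability questions below.\<close>
lemma Phi_ge_min: "min (phi x) (phi (x - 1)) \<le> Phi x"
proof -
  have "integral {x - 1..x} (\<lambda>_. min (phi x) (phi (x - 1))) \<le> integral {x - 1..x} phi"
  proof (rule integral_le)
    show "min (phi x) (phi (x - 1)) \<le> phi t" if "t \<in> {x - 1..x}" for t
    proof (cases "\<bar>t\<bar> \<le> \<bar>x\<bar>")
      case True
      then show ?thesis using phi_mono[of t x] by linarith
    next
      case False
      then have "\<bar>t\<bar> \<le> \<bar>x - 1\<bar>" using that by auto
      then show ?thesis using phi_mono[of t "x - 1"] by linarith
    qed
  qed (auto intro: integrable_continuous_interval phi_cont)
  then show ?thesis
    using Phi_diff[of "x - 1" x] Phi_nonneg[of "x - 1"] by simp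
qed

lemma Phi_pos: "0 < Phi x"
  using Phi_ge_min[of x] phi_pos[of x] phi_pos[of "x - 1"] by linarith

lemma Phi_minus: "Phi (- x) = (\<integral>t. phi t * indicator {x..} t \<partial>lborel)"
  unfolding Phi_def
  by (subst lborel_integral_real_affine[where c = "-1" and t = 0])
     (auto simp: indicator_def phi_minus intro!: Bochner_Integration.integral_cong)

lemma Phi_add_Phi_minus: "Phi x + Phi (- x) = 1"
proof -
  have "Phi x + Phi (- x) = (\<integral>t. phi t * indicator {..x} t + phi t * indicator {x..} t \<partial>lborel)"
    unfolding Phi_minus unfolding Phi_def
    by (rule Bochner_Integration.integral_add[symmetric]) (auto intro: integrable_phi_indicator)
  also have "\<dots> = (\<integral>t. phi t \<partial>lborel)"
  proof (rule integral_cong_AE)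
    have "AE t in lborel. t \<noteq> x"
      by (rule AE_lborel_singleton)
    then show "AE t in lborel. phi t * indicator {..x} t + phi t * indicator {x..} t = phi t"
      by eventually_elim (auto simp: indicator_def)
  qed auto
  finally show ?thesis by simp
qed

lemma phi_tendsto_0: "(phi \<longlongrightarrow> 0) at_top"
proof -
  have "((\<lambda>x::real. (1 / sqrt (2 * pi)) * exp (- x\<^sup>2 / 2)) \<longlongrightarrow> 0) at_top"
    by real_asymp
  then show ?thesis by (simp add: std_normal_density_def[abs_def])
qed

text \<open>Replacing the factor \<open>a\<close> by the integration variable \<open>t \<ge> a\<close> makes the integrand
  the derivative of \<open>- phi\<close>.\<close>
lemma mills_upper:
  assumes "0 \<le> a"
  shows "a * Phi (- a) \<le> phi a"
proof -
  have "ennreal (a * Phi (- a)) = (\<integral>\<^sup>+t. ennreal (a * (phi t * indicator {a..} t)) \<partial>lborel)"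
    unfolding Phi_minus using assms
    by (subst nn_integral_eq_integral) (auto intro: integrable_phi_indicator)
  also have "\<dots> \<le> (\<integral>\<^sup>+t. ennreal (t * phi t) * indicator {a..} t \<partial>lborel)"
    by (intro nn_integral_mono) (auto simp: indicator_def intro!: ennreal_leI mult_right_mono)
  also have "\<dots> = ennreal (0 - - phi a)"
  proof (rule nn_integral_FTC_atLeast)
    show "((\<lambda>x. - phi x) has_real_derivative t * phi t) (at t)" for t
      by (rule derivative_eq_intros phi_DERIV | simp)+
    show "((\<lambda>x. - phi x) \<longlongrightarrow> 0) at_top"
      using tendsto_minus[OF phi_tendsto_0] by simp
  qed (use assms in auto)
  finally show ?thesis
    by (simp add: ennreal_le_iff)
qed

text \<open>This is log-concavity of \<open>Phi\<close>: with \<open>r = phi / Phi = (ln \<circ> Phi)'\<close> one has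
  \<open>r' x = - r x * (x * Phi x + phi x) / Phi x\<close>.\<close>
lemma log_concave_ineq: "0 \<le> x * Phi x + phi x"
proof (cases "0 \<le> x")
  case True
  then show ?thesis by (intro add_nonneg_nonneg mult_nonneg_nonneg Phi_nonneg) auto
next
  case False
  then show ?thesis using mills_upper[of "- x"] by (simp add: phi_minus)
qed

lemma hazard_le: "phi x / Phi x \<le> 1 + exp (1/2 - x)"
proof -
  have *: "phi x = phi (x - 1) * exp (1/2 - x)"
    by (simp add: std_normal_density_def field_simps power2_eq_square flip: exp_add)
  have "phi x \<le> (1 + exp (1/2 - x)) * Phi x"
  proof (cases "phi x \<le> phi (x - 1)")
    case True
    then have "phi x \<le> 1 * Phi x" using Phi_ge_min[of x] by simp
    also have "\<dots> \<le> (1 + exp (1/2 - x)) * Phi x" by (intro mult_right_mono Phi_nonneg) auto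
    finally show ?thesis .
  next
    case False
    then have "phi (x - 1) \<le> Phi x" using Phi_ge_min[of x] by simp
    then have "phi x \<le> exp (1/2 - x) * Phi x"
      unfolding * by (subst mult.commute) (intro mult_left_mono, auto)
    also have "\<dots> \<le> (1 + exp (1/2 - x)) * Phi x" by (intro mult_right_mono Phi_nonneg) auto
    finally show ?thesis .
  qed
  then show ?thesis using Phi_pos[of x] by (simp add: divide_le_eq)
qed

section \<open>The density of the noisy half-normal variable\<close>

text \<open>Folding the line at the origin; the two halves overlap only in the null set \<open>{0}\<close>.\<close>
lemma (in prob_space) distributed_abs_std_normal:
  assumes "distributed M lborel S (\<lambda>x. ennreal (phi x))"
  shows "distributed M lborel (\<lambda>\<omega>. \<bar>S \<omega>\<bar>) (\<lambda>y. ennreal (2 * phi y * indicator {0..} y))"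
  unfolding distributed_def
proof (intro conjI measure_eqI)
  have [measurable]: "S \<in> borel_measurable M"
    using distributed_measurable[OF assms] by simp
  show "(\<lambda>\<omega>. \<bar>S \<omega>\<bar>) \<in> measurable M lborel" by simp
  show "(\<lambda>y. ennreal (2 * phi y * indicator {0..} y)) \<in> borel_measurable lborel" by simp
  show "sets (distr M lborel (\<lambda>\<omega>. \<bar>S \<omega>\<bar>))
      = sets (density lborel (\<lambda>y. ennreal (2 * phi y * indicator {0..} y)))" by simp
  fix A assume "A \<in> sets (distr M lborel (\<lambda>\<omega>. \<bar>S \<omega>\<bar>))"
  then have A [measurable]: "A \<in> sets borel" by simp
  let ?f = "\<lambda>y. ennreal (phi y) * indicator (A \<inter> {0..}) y"
  have "emeasure (distr M lborel (\<lambda>\<omega>. \<bar>S \<omega>\<bar>)) A = (\<integral>\<^sup>+y. indicator A y \<partial>distr M lborel (\<lambda>\<omega>. \<bar>S \<omega>\<bar>))"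
    by simp
  also have "\<dots> = (\<integral>\<^sup>+\<omega>. indicator A \<bar>S \<omega>\<bar> \<partial>M)"
    by (subst nn_integral_distr) auto
  also have "\<dots> = (\<integral>\<^sup>+y. ennreal (phi y) * indicator A \<bar>y\<bar> \<partial>lborel)"
    by (rule distributed_nn_integral[OF assms, symmetric]) simp
  also have "\<dots> = (\<integral>\<^sup>+y. ?f y + ?f (- y) \<partial>lborel)"
  proof (rule nn_integral_cong_AE)
    have "AE y in lborel. y \<noteq> (0::real)"
      by (rule AE_lborel_singleton)
    then show "AE y in lborel. ennreal (phi y) * indicator A \<bar>y\<bar> = ?f y + ?f (- y)"
    proof eventually_elim
      case (elim y)
      then show ?case by (cases "0 < y") (auto simp: indicator_def phi_minus)
    qed
  qed
  also have "\<dots> = (\<integral>\<^sup>+y. ?f y \<partial>lborel) + (\<integral>\<^sup>+y. ?f (- y) \<partial>lborel)"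
    by (rule nn_integral_add) auto
  also have "(\<integral>\<^sup>+y. ?f (- y) \<partial>lborel) = (\<integral>\<^sup>+y. ?f y \<partial>lborel)"
    by (subst (2) nn_integral_real_affine[where c = "-1" and t = 0]) auto
  also have "(\<integral>\<^sup>+y. ?f y \<partial>lborel) + (\<integral>\<^sup>+y. ?f y \<partial>lborel) = (\<integral>\<^sup>+y. ?f y + ?f y \<partial>lborel)"
    by (rule nn_integral_add[symmetric]) auto
  also have "\<dots> = emeasure (density lborel (\<lambda>y. ennreal (2 * phi y * indicator {0..} y))) A"
    by (subst emeasure_density)
       (auto intro!: nn_integral_cong simp: indicator_def simp flip: ennreal_plus)
  finally show "emeasure (distr M lborel (\<lambda>\<omega>. \<bar>S \<omega>\<bar>)) A
      = emeasure (density lborel (\<lambda>y. ennreal (2 * phi y * indicator {0..} y))) A" .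
qed

text \<open>The density of \<open>\<sigma> G + \<bar>S\<bar>\<close>, for \<open>\<sigma> > 0\<close>: a skew normal density.\<close>
definition W_density :: "real \<Rightarrow> real \<Rightarrow> real" where
  "W_density \<sigma> w =
     2 * normal_density 0 (sqrt (1 + \<sigma>\<^sup>2)) w * Phi (w / (\<sigma> * sqrt (1 + \<sigma>\<^sup>2)))"

lemma one_plus_square_pos: "0 < 1 + (\<sigma>::real)\<^sup>2"
  by (simp add: add_pos_nonneg)

lemma W_density_pos: "0 < W_density \<sigma> w"
  unfolding W_density_def
  by (simp add: Phi_pos normal_density_pos one_plus_square_pos)

text \<open>For fixed \<open>w\<close>, the product of the two Gaussian densities in the convolution integral is, as a
  function of \<open>y\<close>, a Gaussian with mean \<open>w / \<tau>\<close> and standard deviation \<open>\<sigma> / sqrt \<tau>\<close>. The variable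
  \<open>t\<close> standardises it, with reversed orientation so that the half line \<open>y \<ge> 0\<close> becomes a lower
  tail in \<open>t\<close>.\<close>
lemma complete_the_square:
  fixes \<sigma> w t :: real
  assumes "0 < \<sigma>"
  defines "\<tau> \<equiv> 1 + \<sigma>\<^sup>2"
  defines "y \<equiv> w / \<tau> - \<sigma> / sqrt \<tau> * t"
  shows "\<sigma> / sqrt \<tau> * (normal_density 0 \<sigma> (w - y) * phi y) = normal_density 0 (sqrt \<tau>) w * phi t"
proof -
  have \<tau>: "0 < \<tau>" unfolding \<tau>_def by (rule one_plus_square_pos)
  define k where "k = sqrt \<tau>"
  have k: "0 < k" "k\<^sup>2 = \<tau>" using \<tau> by (auto simp: k_def)
  have \<sigma>2: "\<sigma>\<^sup>2 = k\<^sup>2 - 1" using k by (simp add: \<tau>_def)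
  have y: "y = w / k\<^sup>2 - \<sigma> / k * t" by (simp add: y_def k k_def[symmetric])
  have "(w - y)\<^sup>2 + \<sigma>\<^sup>2 * y\<^sup>2 = \<sigma>\<^sup>2 * (w\<^sup>2 / k\<^sup>2 + t\<^sup>2)"
  proof -
    have "k ^ 4 * ((w - y)\<^sup>2 + \<sigma>\<^sup>2 * y\<^sup>2)
        = (k\<^sup>2 * w - (w - \<sigma> * k * t))\<^sup>2 + \<sigma>\<^sup>2 * (w - \<sigma> * k * t)\<^sup>2"
      unfolding y using k(1) by (simp add: field_simps power2_eq_square eval_nat_numeral)
    also have "\<dots> = (\<sigma>\<^sup>2 * w + \<sigma> * k * t)\<^sup>2 + \<sigma>\<^sup>2 * (w - \<sigma> * k * t)\<^sup>2"
      by (simp add: \<sigma>2 algebra_simps)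
    also have "\<dots> = (1 + \<sigma>\<^sup>2) * (\<sigma>\<^sup>2 * w\<^sup>2 + \<sigma>\<^sup>2 * k\<^sup>2 * t\<^sup>2)"
      by (simp add: power2_eq_square algebra_simps)
    also have "\<dots> = k\<^sup>2 * (\<sigma>\<^sup>2 * w\<^sup>2 + \<sigma>\<^sup>2 * k\<^sup>2 * t\<^sup>2)"
      by (simp add: k(2) \<tau>_def)
    also have "\<dots> = k ^ 4 * (\<sigma>\<^sup>2 * (w\<^sup>2 / k\<^sup>2 + t\<^sup>2))"
      using k(1) by (simp add: field_simps power2_eq_square eval_nat_numeral)
    finally show ?thesis using k(1) by simp
  qed
  then have e: "(w - y)\<^sup>2 / \<sigma>\<^sup>2 + y\<^sup>2 = w\<^sup>2 / k\<^sup>2 + t\<^sup>2"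
    using assms(1) by (simp add: field_simps)
  have "exp (- (w - y)\<^sup>2 / (2 * \<sigma>\<^sup>2)) * exp (- y\<^sup>2 / 2)
      = exp (- ((w - y)\<^sup>2 / \<sigma>\<^sup>2 + y\<^sup>2) / 2)"
    by (simp add: field_simps flip: exp_add)
  also have "\<dots> = exp (- w\<^sup>2 / (2 * k\<^sup>2)) * exp (- t\<^sup>2 / 2)"
    unfolding e by (simp add: field_simps flip: exp_add)
  finally have "exp (- (w - y)\<^sup>2 / (2 * \<sigma>\<^sup>2)) * exp (- y\<^sup>2 / 2)
      = exp (- w\<^sup>2 / (2 * k\<^sup>2)) * exp (- t\<^sup>2 / 2)" .
  then show ?thesis
    unfolding k_def[symmetric] normal_density_def using assms(1) k(1)
    by (simp add: real_sqrt_mult field_simps)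
qed

lemma half_normal_convolution:
  assumes "0 < \<sigma>"
  shows "(\<integral>\<^sup>+y. ennreal (normal_density 0 \<sigma> (w - y)) * ennreal (2 * phi y * indicator {0..} y) \<partial>lborel)
    = ennreal (W_density \<sigma> w)"
proof -
  define k where "k = sqrt (1 + \<sigma>\<^sup>2)"
  have k: "0 < k" "k\<^sup>2 = 1 + \<sigma>\<^sup>2"
    using one_plus_square_pos[of \<sigma>] by (auto simp: k_def)
  let ?y = "\<lambda>t. w / (1 + \<sigma>\<^sup>2) + - (\<sigma> / k) * t"
  have iff: "0 \<le> ?y t \<longleftrightarrow> t \<le> w / (\<sigma> * k)" for t
    using k(1) assms unfolding k(2)[symmetric] by (simp add: field_simps power2_eq_square)
  have eq: "ennreal \<bar>- (\<sigma> / k)\<bar> * (ennreal (normal_density 0 \<sigma> (w - ?y t))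
        * ennreal (2 * phi (?y t) * indicator {0..} (?y t)))
      = ennreal (2 * normal_density 0 k w * (phi t * indicator {..w / (\<sigma> * k)} t))" for t
  proof -
    have "\<sigma> / k * (normal_density 0 \<sigma> (w - ?y t) * phi (?y t)) = normal_density 0 k w * phi t"
      using complete_the_square[OF assms, of w t] by (simp add: k_def)
    moreover have "\<sigma> / k * (normal_density 0 \<sigma> (w - ?y t) * (2 * phi (?y t) * indicator {0..} (?y t)))
      = \<sigma> / k * (normal_density 0 \<sigma> (w - ?y t) * phi (?y t)) * (2 * indicator {0..} (?y t))"
      by (simp only: mult_ac)
    moreover have "indicator {0..} (?y t) = (indicator {..w / (\<sigma> * k)} t :: real)"
      using iff[of t] by (simp only: indicator_def atLeast_iff atMost_iff)
    ultimately have "\<sigma> / k * (normal_density 0 \<sigma> (w - ?y t) * (2 * phi (?y t) * indicator {0..} (?y t)))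
      = 2 * normal_density 0 k w * (phi t * indicator {..w / (\<sigma> * k)} t)"
      by (simp only: mult_ac)
    then show ?thesis
      using assms k(1) by (simp add: abs_of_pos flip: ennreal_mult')
  qed
  have "(\<integral>\<^sup>+y. ennreal (normal_density 0 \<sigma> (w - y)) * ennreal (2 * phi y * indicator {0..} y) \<partial>lborel)
    = (\<integral>\<^sup>+t. ennreal (2 * normal_density 0 k w * (phi t * indicator {..w / (\<sigma> * k)} t)) \<partial>lborel)"
    unfolding eq[symmetric]
    by (subst nn_integral_real_affine[where c = "- (\<sigma> / k)" and t = "w / (1 + \<sigma>\<^sup>2)"])
       (use assms k(1) in \<open>auto intro!: nn_integral_cmult[symmetric] simp del: abs_minus_cancel abs_divide\<close>)
  also have "\<dots> = ennreal (\<integral>t. 2 * normal_density 0 k w * (phi t * indicator {..w / (\<sigma> * k)} t) \<partial>lborel)"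
    by (rule nn_integral_eq_integral)
       (auto intro!: integrable_mult_right integrable_phi_indicator)
  also have "(\<integral>t. 2 * normal_density 0 k w * (phi t * indicator {..w / (\<sigma> * k)} t) \<partial>lborel)
      = W_density \<sigma> w"
    by (simp add: W_density_def Phi_def k_def)
  finally show ?thesis .
qed

text \<open>The derivative is displayed as density times score, the score being
  \<open>c r(c w) - w / \<tau>\<close> with \<open>r = phi / Phi\<close> and \<open>\<tau> = 1 + \<sigma>\<^sup>2\<close>.\<close>
lemma W_density_DERIV:
  fixes w \<sigma> :: real
  defines "c \<equiv> 1 / (\<sigma> * sqrt (1 + \<sigma>\<^sup>2))"
  shows "(W_density \<sigma> has_real_derivative
    W_density \<sigma> w * (c * (phi (c * w) / Phi (c * w)) - w / (1 + \<sigma>\<^sup>2))) (at w)"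
proof -
  define k where "k = sqrt (1 + \<sigma>\<^sup>2)"
  have k: "0 < k" "k\<^sup>2 = 1 + \<sigma>\<^sup>2"
    using one_plus_square_pos[of \<sigma>] by (auto simp: k_def)
  have n: "(normal_density 0 k has_real_derivative - (w / k\<^sup>2) * normal_density 0 k w) (at w)"
    unfolding normal_density_def using k(1)
    by (auto intro!: derivative_eq_intros simp: field_simps power2_eq_square)
  have P: "((\<lambda>w. Phi (c * w)) has_real_derivative phi (c * w) * c) (at w)"
    by (rule DERIV_chain2[OF Phi_DERIV]) (auto intro!: derivative_eq_intros)
  have "((\<lambda>w. 2 * normal_density 0 k w * Phi (c * w)) has_real_derivative
      2 * normal_density 0 k w * Phi (c * w) * (c * (phi (c * w) / Phi (c * w)) - w / k\<^sup>2)) (at w)"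
    by (rule derivative_eq_intros n P refl)+ (use Phi_pos[of "c * w"] in \<open>simp add: field_simps\<close>)
  moreover have "W_density \<sigma> = (\<lambda>w. 2 * normal_density 0 k w * Phi (c * w))"
    by (simp add: fun_eq_iff W_density_def c_def k_def)
  ultimately show ?thesis by (simp add: k(2))
qed

context prob_space
begin

context
  fixes G S :: "'a \<Rightarrow> real"
  assumes G: "distributed M lborel G (\<lambda>x. ennreal (phi x))"
    and S: "distributed M lborel S (\<lambda>x. ennreal (phi x))"
    and indep: "indep_var borel G borel S"
begin

lemma distributed_W:
  assumes "0 < \<sigma>"
  shows "distributed M lborel (W_var G S sgn \<sigma>) (\<lambda>w. ennreal (W_density \<sigma> w))"
proof -
  have "distributed M lborel (\<lambda>\<omega>. 0 + \<sigma> * G \<omega>) (\<lambda>x. ennreal (normal_density (0 + \<sigma> * 0) (\<bar>\<sigma>\<bar> * 1) x))"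
    by (rule normal_density_affine[OF G]) (use assms in auto)
  then have \<sigma>G: "distributed M lborel (\<lambda>\<omega>. \<sigma> * G \<omega>) (\<lambda>x. ennreal (normal_density 0 \<sigma> x))"
    using assms by simp
  have "indep_var borel ((\<lambda>x. \<sigma> * x) \<circ> G) borel (abs \<circ> S)"
    by (rule indep_var_compose[OF indep]) auto
  then have "indep_var borel (\<lambda>\<omega>. \<sigma> * G \<omega>) borel (\<lambda>\<omega>. \<bar>S \<omega>\<bar>)"
    by (simp add: comp_def)
  from distributed_convolution[OF this \<sigma>G distributed_abs_std_normal[OF S]]
  have "distributed M lborel (\<lambda>\<omega>. \<sigma> * G \<omega> + \<bar>S \<omega>\<bar>) (\<lambda>w. ennreal (W_density \<sigma> w))"
    by (simp add: half_normal_convolution[OF assms])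
  then show ?thesis
    by (simp add: W_var_def abs_sgn)
qed

lemma diff_density_W:
  assumes "0 < \<sigma>"
  shows "diff_density M (W_var G S sgn \<sigma>) = W_density \<sigma>"
proof -
  have "is_diff_density M (W_var G S sgn \<sigma>) (W_density \<sigma>)"
    unfolding is_diff_density_def
    using distributed_W[OF assms] W_density_DERIV W_density_pos
    by (auto intro: less_imp_le simp: real_differentiable_def)
  then show ?thesis
    unfolding diff_density_def
    using is_diff_density_unique[OF prob_space_axioms] by blast
qed

end

end

section \<open>The second moment of the ratio of density and distribution function\<close>

text \<open>Up to the factor \<open>2 \<sigma>\<close> this is the expectation of \<open>(r(c W\<^sub>\<sigma>))\<^sup>2\<close> with \<open>r = phi / Phi\<close> and
  \<open>c = 1 / (\<sigma> sqrt (1 + \<sigma>\<^sup>2))\<close>, after the substitution \<open>w = x / c\<close>. In this form the integrand has an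
  integrable majorant that is independent of \<open>\<sigma>\<close>.\<close>
definition hazard_moment :: "real \<Rightarrow> real" where
  "hazard_moment \<sigma> = (\<integral>x. phi (\<sigma> * x) * ((phi x)\<^sup>2 / Phi x) \<partial>lborel)"

text \<open>In the bound \<open>phi / Phi \<le> 1 + exp (1/2 - x)\<close> the exponential is exactly what shifts the
  Gaussian, so that the majorant is a sum of two Gaussian densities.\<close>
lemma phi_square_over_Phi_le: "(phi x)\<^sup>2 / Phi x \<le> phi x + exp 1 * phi (1 + x)"
proof -
  have "exp 1 * phi (1 + x) = phi x * exp (1/2 - x)"
    by (simp add: std_normal_density_def field_simps power2_eq_square flip: exp_add)
  moreover have "phi x * (phi x / Phi x) \<le> phi x * (1 + exp (1/2 - x))"
    by (intro mult_left_mono hazard_le) auto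
  ultimately show ?thesis by (simp add: power2_eq_square algebra_simps)
qed

lemma phi_square_over_Phi_nonneg: "0 \<le> (phi x)\<^sup>2 / Phi x"
  by (simp add: Phi_nonneg)

lemma integrable_majorant: "integrable lborel (\<lambda>x. phi x + exp 1 * phi (1 + x))"
proof (intro Bochner_Integration.integrable_add integrable_mult_right integrable_normal_density)
  have "integrable lborel (\<lambda>x. phi (1 + 1 * x))"
    by (rule lborel_integrable_real_affine[OF integrable_normal_density]) simp_all
  then show "integrable lborel (\<lambda>x. phi (1 + x))"
    by (simp only: mult_1)
qed simp_all

lemma phi_le_1: "phi x \<le> 1"
proof -
  have "phi x \<le> phi 0" by (rule phi_mono) simp
  also have "phi 0 \<le> 1"
    using pi_gt3 by (simp add: std_normal_density_def divide_le_eq)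
  finally show ?thesis .
qed

lemma hazard_moment_integrand_le:
  "norm (phi (\<sigma> * x) * ((phi x)\<^sup>2 / Phi x)) \<le> phi x + exp 1 * phi (1 + x)"
proof -
  have "norm (phi (\<sigma> * x) * ((phi x)\<^sup>2 / Phi x)) = phi (\<sigma> * x) * ((phi x)\<^sup>2 / Phi x)"
    by (simp add: abs_mult Phi_nonneg)
  also have "\<dots> \<le> 1 * ((phi x)\<^sup>2 / Phi x)"
    by (intro mult_right_mono phi_le_1 phi_square_over_Phi_nonneg)
  finally show ?thesis using phi_square_over_Phi_le[of x] by linarith
qed

lemma integrable_hazard_moment:
  "integrable lborel (\<lambda>x. phi (\<sigma> * x) * ((phi x)\<^sup>2 / Phi x))"
  by (rule Bochner_Integration.integrable_bound[OF integrable_majorant])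
     (use hazard_moment_integrand_le in \<open>auto intro: order_trans[OF _ abs_ge_self]\<close>)

lemma hazard_moment_nonneg: "0 \<le> hazard_moment \<sigma>"
  unfolding hazard_moment_def
  by (intro integral_nonneg_AE AE_I2 mult_nonneg_nonneg phi_square_over_Phi_nonneg) simp

lemma hazard_moment_cont: "isCont hazard_moment \<sigma>"
  unfolding continuous_at_sequentially comp_def hazard_moment_def
proof (intro allI impI)
  fix s :: "nat \<Rightarrow> real" assume s: "s \<longlonglongrightarrow> \<sigma>"
  show "(\<lambda>n. \<integral>x. phi (s n * x) * ((phi x)\<^sup>2 / Phi x) \<partial>lborel)
    \<longlonglongrightarrow> (\<integral>x. phi (\<sigma> * x) * ((phi x)\<^sup>2 / Phi x) \<partial>lborel)"
  proof (rule integral_dominated_convergence[OF _ _ integrable_majorant])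
    have "(\<lambda>n. phi (s n * x)) \<longlonglongrightarrow> phi (\<sigma> * x)" for x
      by (rule isCont_tendsto_compose[OF DERIV_isCont[OF phi_DERIV]]) (intro tendsto_intros s)
    then show "AE x in lborel. (\<lambda>n. phi (s n * x) * ((phi x)\<^sup>2 / Phi x))
        \<longlonglongrightarrow> phi (\<sigma> * x) * ((phi x)\<^sup>2 / Phi x)"
      by (intro AE_I2 tendsto_mult_right)
  qed (use hazard_moment_integrand_le in auto)
qed

text \<open>Any bound of order \<open>1 / \<sigma>\<close> serves to lift \<open>\<kappa>\<close> above every level below \<open>1\<close>; this
  one comes from the interval \<open>[0, 1/\<sigma>]\<close>, where both Gaussian factors are at least \<open>phi 1\<close>.\<close>
lemma hazard_moment_lower:
  assumes "1 \<le> \<sigma>"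
  shows "phi 1 ^ 3 \<le> \<sigma> * hazard_moment \<sigma>"
proof -
  have "phi 1 ^ 3 / \<sigma> = (\<integral>x. phi 1 ^ 3 * indicator {0..1 / \<sigma>} x \<partial>lborel)"
    using assms by simp
  also have "\<dots> \<le> hazard_moment \<sigma>"
    unfolding hazard_moment_def
  proof (intro integral_mono integrable_hazard_moment)
    show "phi 1 ^ 3 * indicator {0..1 / \<sigma>} x \<le> phi (\<sigma> * x) * ((phi x)\<^sup>2 / Phi x)" for x
    proof (cases "x \<in> {0..1 / \<sigma>}")
      case True
      then have x: "0 \<le> x" "\<sigma> * x \<le> 1" using assms by (auto simp: field_simps)
      moreover have "x \<le> \<sigma> * x" using x assms by (simp add: mult_le_cancel_right1)
      ultimately have "phi 1 \<le> phi (\<sigma> * x)" "phi 1 \<le> phi x"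
        using assms by (auto intro!: phi_mono)
      moreover have "(phi x)\<^sup>2 \<le> (phi x)\<^sup>2 / Phi x"
        using Phi_pos[of x] Phi_le_1[of x] by (simp add: le_divide_eq mult_left_le)
      moreover have "(phi 1)\<^sup>2 \<le> (phi x)\<^sup>2"
        using \<open>phi 1 \<le> phi x\<close> by (intro power_mono) auto
      ultimately have "phi 1 * (phi 1)\<^sup>2 \<le> phi (\<sigma> * x) * ((phi x)\<^sup>2 / Phi x)"
        by (intro mult_mono order_trans[OF \<open>(phi 1)\<^sup>2 \<le> (phi x)\<^sup>2\<close>]) auto
      then show ?thesis using True by (simp add: power3_eq_cube power2_eq_square mult.assoc)
    next
      case False
      then show ?thesis by (simp add: Phi_nonneg)
    qed
  qed (auto intro: integrable_real_indicator simp: emeasure_lborel_Icc_eq)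
  finally show ?thesis using assms by (simp add: field_simps)
qed

section \<open>The Fisher information\<close>

lemma integral_odd:
  fixes f :: "real \<Rightarrow> real"
  assumes "\<And>x. f (- x) = - f x"
  shows "(\<integral>x. f x \<partial>lborel) = 0"
proof -
  have "(\<integral>x. f x \<partial>lborel) = - (\<integral>x. f x \<partial>lborel)"
    by (subst lborel_integral_real_affine[where c = "-1" and t = 0]) (auto simp: assms)
  then show ?thesis by simp
qed

text \<open>Reflecting the line exchanges \<open>Phi (c x)\<close> and \<open>Phi (- c x) = 1 - Phi (c x)\<close>.\<close>
lemma integral_even_times_Phi:
  fixes f :: "real \<Rightarrow> real"
  assumes f: "integrable lborel f" and even: "\<And>x. f (- x) = f x"
  shows "integrable lborel (\<lambda>x. f x * Phi (c * x))"
    and "(\<integral>x. f x * Phi (c * x) \<partial>lborel) = (\<integral>x. f x \<partial>lborel) / 2"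
proof -
  have [measurable]: "f \<in> borel_measurable borel"
    using borel_measurable_integrable[OF f] by simp
  show int: "integrable lborel (\<lambda>x. f x * Phi (c * x))" for c
    by (rule Bochner_Integration.integrable_bound[OF f])
       (auto simp: abs_mult Phi_nonneg Phi_le_1 intro!: mult_left_le)
  have "(\<integral>x. f x * Phi (c * x) \<partial>lborel) = (\<integral>x. f x * Phi (- c * x) \<partial>lborel)"
    by (subst lborel_integral_real_affine[where c = "-1" and t = 0]) (auto simp: even)
  then have "2 * (\<integral>x. f x * Phi (c * x) \<partial>lborel)
      = (\<integral>x. f x * Phi (c * x) + f x * Phi (- c * x) \<partial>lborel)"
    using int[of c] int[of "- c"] by simp
  also have "\<dots> = (\<integral>x. f x \<partial>lborel)"
  proof (rule Bochner_Integration.integral_cong[OF refl])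
    fix x
    have "f x * Phi (c * x) + f x * Phi (- c * x) = f x * (Phi (c * x) + Phi (- (c * x)))"
      by (simp add: algebra_simps)
    then show "f x * Phi (c * x) + f x * Phi (- c * x) = f x"
      by (simp only: Phi_add_Phi_minus mult_1_right)
  qed
  finally show "(\<integral>x. f x * Phi (c * x) \<partial>lborel) = (\<integral>x. f x \<partial>lborel) / 2" by simp
qed

text \<open>Expanding the square of the score gives three terms. The first is the second moment of a centred
  Gaussian, since \<open>Phi\<close> contributes only a factor \<open>1/2\<close> to an even integrand. In the cross term
  \<open>Phi\<close> cancels and an odd function remains. The last is the expected square of \<open>c r(c W)\<close>.\<close>
lemma integral_score_square:
  fixes \<sigma> :: real
  assumes "0 < \<sigma>"
  defines "c \<equiv> 1 / (\<sigma> * sqrt (1 + \<sigma>\<^sup>2))"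
  shows "(\<integral>w. W_density \<sigma> w * (c * (phi (c * w) / Phi (c * w)) - w / (1 + \<sigma>\<^sup>2))\<^sup>2 \<partial>lborel)
    = (1 + 2 * hazard_moment \<sigma> / \<sigma>) / (1 + \<sigma>\<^sup>2)"
proof -
  define \<tau> k where "\<tau> = 1 + \<sigma>\<^sup>2" and "k = sqrt \<tau>"
  have \<tau>: "0 < \<tau>" by (simp add: \<tau>_def one_plus_square_pos)
  then have k: "0 < k" "k\<^sup>2 = \<tau>" by (auto simp: k_def)
  have c: "c = 1 / (\<sigma> * k)" "0 < c" using assms k(1) by (auto simp: c_def k_def \<tau>_def)
  let ?n = "normal_density 0 k"
  \<comment> \<open>Square of the linear part of the score, cross term, square of the \<open>phi / Phi\<close> part.\<close>
  let ?h1 = "\<lambda>w. (2 / \<tau>\<^sup>2) * ((?n w * w\<^sup>2) * Phi (c * w))"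
  let ?h2 = "\<lambda>w. (4 * c / \<tau>) * (?n w * w * phi (c * w))"
  let ?h3 = "\<lambda>w. (2 * c\<^sup>2) * (?n w * ((phi (c * w))\<^sup>2 / Phi (c * w)))"
  have split: "W_density \<sigma> w * (c * (phi (c * w) / Phi (c * w)) - w / (1 + \<sigma>\<^sup>2))\<^sup>2
      = ?h1 w - ?h2 w + ?h3 w" for w
  proof -
    have "W_density \<sigma> w = 2 * ?n w * Phi (c * w)"
      by (simp add: W_density_def c_def k_def \<tau>_def)
    then show ?thesis
      unfolding \<tau>_def[symmetric] using \<tau> Phi_pos[of "c * w"]
      by (simp add: field_simps power2_eq_square)
  qed
  have even: "?n (- w) = ?n w" for w by (simp add: normal_density_def)
  have m2: "has_bochner_integral lborel (\<lambda>w. ?n w * w\<^sup>2) \<tau>"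
    using normal_moment_even[OF k(1), of 0 1] k by (simp add: fact_numeral power_divide)
  have i1: "integrable lborel ?h1" and v1: "(\<integral>w. ?h1 w \<partial>lborel) = 1 / \<tau>"
  proof -
    have i: "integrable lborel (\<lambda>w. ?n w * w\<^sup>2)" and v: "(\<integral>w. ?n w * w\<^sup>2 \<partial>lborel) = \<tau>"
      using m2 by (auto simp: has_bochner_integral_iff)
    have e: "?n (- w) * (- w)\<^sup>2 = ?n w * w\<^sup>2" for w by (simp add: even)
    show "integrable lborel ?h1"
      by (intro integrable_mult_right integral_even_times_Phi(1)[OF i e])
    show "(\<integral>w. ?h1 w \<partial>lborel) = 1 / \<tau>"
      unfolding Bochner_Integration.integral_mult_right_zero integral_even_times_Phi(2)[OF i e] v
      using \<tau> by (simp add: power2_eq_square)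
  qed
  have i2: "integrable lborel ?h2"
  proof (rule integrable_mult_right)
    show "integrable lborel (\<lambda>w. ?n w * w * phi (c * w))"
      by (rule Bochner_Integration.integrable_bound[OF integrable_normal_moment_nz_1[OF k(1), of 0]])
         (auto simp: abs_mult phi_le_1 intro!: mult_left_le)
  qed
  have v2: "(\<integral>w. ?h2 w \<partial>lborel) = 0"
    by (rule integral_odd) (use even phi_minus in simp)
  have sub: "?n (0 + \<sigma> * k * x) * ((phi (c * (0 + \<sigma> * k * x)))\<^sup>2 / Phi (c * (0 + \<sigma> * k * x)))
      = (1 / k) * (phi (\<sigma> * x) * ((phi x)\<^sup>2 / Phi x))" for x
  proof -
    have "?n (\<sigma> * k * x) = (1 / k) * phi (\<sigma> * x)"
      using k(1) by (simp add: normal_density_def real_sqrt_mult power_mult_distrib)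
    moreover have "c * (\<sigma> * k * x) = x" using assms(1) k(1) by (simp add: c(1))
    ultimately show ?thesis by (simp only: add_0 mult.assoc)
  qed
  have \<sigma>k: "\<sigma> * k \<noteq> 0" using assms k(1) by simp
  have "integrable lborel (\<lambda>x. ?n (0 + \<sigma> * k * x) * ((phi (c * (0 + \<sigma> * k * x)))\<^sup>2 / Phi (c * (0 + \<sigma> * k * x))))"
    unfolding sub by (intro integrable_mult_right integrable_hazard_moment)
  then have "integrable lborel (\<lambda>w. ?n w * ((phi (c * w))\<^sup>2 / Phi (c * w)))"
    by (rule lborel_integrable_real_affine_iff[OF \<sigma>k, THEN iffD1])
  then have i3: "integrable lborel ?h3"
    by (rule integrable_mult_right)
  have "(\<integral>w. ?n w * ((phi (c * w))\<^sup>2 / Phi (c * w)) \<partial>lborel)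
      = \<bar>\<sigma> * k\<bar> * (1 / k * hazard_moment \<sigma>)"
    by (subst lborel_integral_real_affine[OF \<sigma>k, where t = 0])
       (simp only: sub hazard_moment_def real_scaleR_def Bochner_Integration.integral_mult_right_zero)
  then have "(\<integral>w. ?n w * ((phi (c * w))\<^sup>2 / Phi (c * w)) \<partial>lborel) = \<sigma> * hazard_moment \<sigma>"
    using assms k(1) by (simp add: abs_mult)
  then have v3: "(\<integral>w. ?h3 w \<partial>lborel) = 2 * hazard_moment \<sigma> / (\<sigma> * \<tau>)"
    unfolding Bochner_Integration.integral_mult_right_zero
    using assms(1) k(1) by (simp add: c(1) k(2)[symmetric] power2_eq_square field_simps)
  have "(\<integral>w. ?h1 w - ?h2 w + ?h3 w \<partial>lborel) = 1 / \<tau> + 2 * hazard_moment \<sigma> / (\<sigma> * \<tau>)"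
    using i1 i2 i3 by (simp only: Bochner_Integration.integral_add Bochner_Integration.integral_diff
        Bochner_Integration.integrable_diff v1 v2 v3)
  also have "\<dots> = (1 + 2 * hazard_moment \<sigma> / \<sigma>) / \<tau>"
    using assms(1) \<tau> by (simp add: field_simps)
  finally show ?thesis
    unfolding split \<tau>_def .
qed

context prob_space
begin

context
  fixes G S :: "'a \<Rightarrow> real"
  assumes G: "distributed M lborel G (\<lambda>x. ennreal (phi x))"
    and S: "distributed M lborel S (\<lambda>x. ennreal (phi x))"
    and indep: "indep_var borel G borel S"
begin

lemma fisher_information_W:
  assumes "0 < \<sigma>"
  shows "fisher_information M (W_var G S sgn \<sigma>) = (1 + 2 * hazard_moment \<sigma> / \<sigma>) / (1 + \<sigma>\<^sup>2)"
proof -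
  define c where "c = 1 / (\<sigma> * sqrt (1 + \<sigma>\<^sup>2))"
  let ?score = "\<lambda>w. c * (phi (c * w) / Phi (c * w)) - w / (1 + \<sigma>\<^sup>2)"
  have "deriv (W_density \<sigma>) w / W_density \<sigma> w = ?score w" for w
    using DERIV_imp_deriv[OF W_density_DERIV, of \<sigma> w] W_density_pos[of \<sigma> w] by (simp add: c_def)
  then have "fisher_information M (W_var G S sgn \<sigma>)
      = (\<integral>\<omega>. (?score (W_var G S sgn \<sigma> \<omega>))\<^sup>2 \<partial>M)"
    by (simp add: fisher_information_def diff_density_W[OF G S indep assms])
  also have "\<dots> = (\<integral>w. W_density \<sigma> w * (?score w)\<^sup>2 \<partial>lborel)"
    by (rule distributed_integral[OF distributed_W[OF G S indep assms], symmetric])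
       (auto intro: less_imp_le W_density_pos)
  also have "\<dots> = (1 + 2 * hazard_moment \<sigma> / \<sigma>) / (1 + \<sigma>\<^sup>2)"
    unfolding c_def by (rule integral_score_square[OF assms])
  finally show ?thesis .
qed

section \<open>The function kappa and the optimal noise level\<close>

text \<open>With \<open>A = 2 \<sigma> * hazard_moment \<sigma>\<close>, the formula for the Fisher information reads
  \<open>\<sigma>\<^sup>2 ((1 + \<sigma>\<^sup>2) I - 1) = A\<close>. The right-hand side is free of singularities on the closed half
  line, and its value at \<open>\<sigma> = 0\<close> agrees with the convention \<open>\<kappa>(0) = 0\<close>.\<close>
lemma kappa_eq:
  assumes "0 \<le> \<sigma>"
  shows "kappa M G S sgn \<sigma> = (1 + \<sigma>\<^sup>2) * (2 * \<sigma> * hazard_moment \<sigma>)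
    / (1 + \<sigma>\<^sup>2 * (2 * \<sigma> * hazard_moment \<sigma>))"
proof (cases "\<sigma> = 0")
  case True
  then show ?thesis by (simp add: kappa_def)
next
  case False
  then have \<sigma>: "0 < \<sigma>" using assms by simp
  define I H \<tau> where "I = fisher_information M (W_var G S sgn \<sigma>)"
    and "H = hazard_moment \<sigma>" and "\<tau> = 1 + \<sigma>\<^sup>2"
  have \<tau>: "0 < \<tau>" by (simp add: \<tau>_def one_plus_square_pos)
  have I: "\<tau> * I = 1 + 2 * H / \<sigma>"
    unfolding I_def fisher_information_W[OF \<sigma>] H_def using \<tau> by (simp add: \<tau>_def)
  have num: "\<sigma>\<^sup>2 * (\<sigma>\<^sup>2 * I + I - 1) = 2 * \<sigma> * H"
  proof -
    have "\<sigma>\<^sup>2 * I + I - 1 = \<tau> * I - 1" by (simp add: \<tau>_def algebra_simps)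
    then show ?thesis unfolding I using \<sigma> by (simp add: power2_eq_square)
  qed
  have "\<tau> * (1 + \<sigma>\<^sup>2 * (\<sigma>\<^sup>2 * I - 1)) = \<tau> + \<sigma>\<^sup>2 * (\<sigma>\<^sup>2 * (\<tau> * I) - \<tau>)"
    by (simp add: algebra_simps)
  also have "\<dots> = 1 + \<sigma>\<^sup>2 * (2 * \<sigma> * H)"
    unfolding I using \<sigma> by (simp add: \<tau>_def field_simps power2_eq_square)
  finally have "1 + \<sigma>\<^sup>2 * (\<sigma>\<^sup>2 * I - 1) = (1 + \<sigma>\<^sup>2 * (2 * \<sigma> * H)) / \<tau>"
    using \<tau> by (simp add: field_simps)
  then have "kappa M G S sgn \<sigma> = 2 * \<sigma> * H / ((1 + \<sigma>\<^sup>2 * (2 * \<sigma> * H)) / \<tau>)"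
    using \<sigma> by (simp add: kappa_def Let_def num flip: I_def)
  then show ?thesis by (simp add: H_def \<tau>_def mult.commute)
qed

text \<open>This is where \<open>\<delta> > 1\<close> enters: \<open>\<kappa>\<close> is continuous on \<open>[0, \<infinity>)\<close>, vanishes at \<open>0\<close> and reaches
  the level \<open>1/\<delta> < 1\<close>, so its level set is closed and nonempty and has a least element, which
  cannot be \<open>0\<close>. Positivity matters because \<open>\<bar>S\<bar>\<close> itself has no differentiable density.\<close>
lemma sigma_opt_pos:
  assumes "1 < \<delta>"
  shows "0 < sigma_opt M G S sgn \<delta>"
proof -
  define K where "K \<sigma> = (1 + \<sigma>\<^sup>2) * (2 * \<sigma> * hazard_moment \<sigma>)
    / (1 + \<sigma>\<^sup>2 * (2 * \<sigma> * hazard_moment \<sigma>))" for \<sigma>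
  have den: "0 < 1 + \<sigma>\<^sup>2 * (2 * \<sigma> * hazard_moment \<sigma>)" if "0 \<le> \<sigma>" for \<sigma>
    using that hazard_moment_nonneg[of \<sigma>] by (simp add: add_pos_nonneg)
  have cont: "continuous_on {0..} K"
    unfolding K_def
    by (intro continuous_intros continuous_at_imp_continuous_on ballI hazard_moment_cont
        less_imp_neq[OF den, symmetric]) auto
  define P where "P \<sigma> \<longleftrightarrow> 0 \<le> \<sigma> \<and> kappa M G S sgn \<sigma> = 1 / \<delta>" for \<sigma>
  have P: "P \<sigma> \<longleftrightarrow> 0 \<le> \<sigma> \<and> K \<sigma> = 1 / \<delta>" for \<sigma>
    by (auto simp: P_def K_def kappa_eq)
  have "\<exists>b\<ge>0. 1 / \<delta> \<le> K b"
  proof -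
    define m where "m = 2 * phi 1 ^ 3"
    have m: "0 < m" by (simp add: m_def phi_pos)
    \<comment> \<open>As \<open>m \<le> A\<close> and \<open>b \<ge> 1\<close>, the inequality \<open>b * m * (\<delta> - 1) \<ge> 1\<close> gives \<open>b\<^sup>2 A / (1 + b\<^sup>2 A) \<ge> 1/\<delta>\<close>.\<close>
    define b where "b = 1 + 1 / (m * (\<delta> - 1))"
    have b: "1 \<le> b" using m assms by (simp add: b_def)
    define A where "A = 2 * b * hazard_moment b"
    have A: "m \<le> A" using hazard_moment_lower[OF b] by (simp add: m_def A_def)
    have "1 \<le> b * (m * (\<delta> - 1))" using m assms by (simp add: b_def distrib_right)
    also have "b * (m * (\<delta> - 1)) \<le> b\<^sup>2 * (A * (\<delta> - 1))"
      using b A m assms by (intro mult_mono mult_right_mono) (auto simp: power2_eq_square)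
    finally have "1 + b\<^sup>2 * A \<le> \<delta> * (b\<^sup>2 * A)" by (simp add: algebra_simps)
    also have "\<dots> \<le> \<delta> * ((1 + b\<^sup>2) * A)"
      using A m assms by (intro mult_left_mono mult_right_mono) auto
    finally have "1 / \<delta> \<le> (1 + b\<^sup>2) * A / (1 + b\<^sup>2 * A)"
      using assms den[of b] b by (simp add: A_def field_simps)
    then have "1 / \<delta> \<le> K b" by (simp add: K_def A_def)
    then show ?thesis using b by (intro exI[of _ b]) auto
  qed
  then obtain b where b: "0 \<le> b" "1 / \<delta> \<le> K b" by blast
  have "\<exists>x\<ge>0. x \<le> b \<and> K x = 1 / \<delta>"
    using assms b by (intro IVT' continuous_on_subset[OF cont]) (auto simp: K_def)
  then have ne: "Collect P \<noteq> {}" by (auto simp: P)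
  have "closed {\<sigma> \<in> {0..}. K \<sigma> = 1 / \<delta>}"
    using cont by (intro continuous_closed_preimage_constant) auto
  moreover have eq: "Collect P = {\<sigma> \<in> {0..}. K \<sigma> = 1 / \<delta>}" by (auto simp: P)
  ultimately have closed: "closed (Collect P)" by simp
  have bdd: "bdd_below (Collect P)" by (rule bdd_belowI[of _ 0]) (auto simp: P)
  have "Inf (Collect P) \<in> Collect P"
    by (rule closed_contains_Inf[OF ne bdd closed])
  moreover have "sigma_opt M G S sgn \<delta> = Inf (Collect P)"
    unfolding sigma_opt_def
    using calculation by (intro Least_equality) (auto simp flip: P_def intro: cInf_lower bdd)
  ultimately have "P (sigma_opt M G S sgn \<delta>)" by simp
  moreover have "\<not> P 0" using assms by (simp add: P K_def)
  ultimately show ?thesis by (metis P less_eq_real_def)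
qed

end

end

section \<open>Convexity of the optimal loss\<close>

lemma convex_quadratic_minus_ln_Phi:
  assumes "0 \<le> a" "0 \<le> b"
  shows "convex_on UNIV (\<lambda>v. a * v\<^sup>2 / 2 - b * ln (Phi (c * v)) + d)"
proof (rule f''_ge0_imp_convex)
  let ?r = "\<lambda>v. phi (c * v) / Phi (c * v)"
  have P: "((\<lambda>v. Phi (c * v)) has_real_derivative phi (c * v) * c) (at v)" for v
    by (rule DERIV_chain2[OF Phi_DERIV]) (auto intro!: derivative_eq_intros)
  have p: "((\<lambda>v. phi (c * v)) has_real_derivative - (c * v) * phi (c * v) * c) (at v)" for v
    by (rule DERIV_chain2[OF phi_DERIV]) (auto intro!: derivative_eq_intros)
  show "((\<lambda>v. a * v\<^sup>2 / 2 - b * ln (Phi (c * v)) + d) has_real_derivative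
      a * v - b * c * ?r v) (at v)" for v
    using Phi_pos[of "c * v"] by (auto intro!: derivative_eq_intros P)
  have r: "(?r has_real_derivative - c * (?r v * (c * v * Phi (c * v) + phi (c * v)) / Phi (c * v))) (at v)" for v
    by (rule DERIV_cong[OF DERIV_divide[OF p P]])
       (use Phi_pos[of "c * v"] in \<open>auto simp: field_simps\<close>)
  show "((\<lambda>v. a * v - b * c * ?r v) has_real_derivative
      a + b * c\<^sup>2 * (?r v * (c * v * Phi (c * v) + phi (c * v)) / Phi (c * v))) (at v)" for v
    by (rule derivative_eq_intros r refl)+ (simp add: power2_eq_square)
  show "0 \<le> a + b * c\<^sup>2 * (?r v * (c * v * Phi (c * v) + phi (c * v)) / Phi (c * v))" for v
    by (intro add_nonneg_nonneg mult_nonneg_nonneg divide_nonneg_nonneg Phi_nonneg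
        log_concave_ineq assms) auto
qed auto

text \<open>Substituting \<open>v = x + u\<close>, the negated envelope is the supremum over \<open>u\<close> of the functions
  \<open>x \<mapsto> - u\<^sup>2 / (2 l) - h (x + u)\<close>, each of which is a translate of the convex function \<open>- h\<close> plus
  a constant. The supremum may be \<open>\<infinity>\<close>.\<close>
lemma ereal_convex_on_minus_moreau_envelope:
  assumes "convex_on UNIV (\<lambda>v. - h v)"
  shows "ereal_convex_on UNIV (\<lambda>x. - moreau_envelope h x l)"
proof -
  define q where "q u x = - (1 / (2 * l) * u\<^sup>2) - h (x + u)" for u x
  have env: "- moreau_envelope h x l = (SUP u. ereal (q u x))" for x
  proof -
    have "- moreau_envelope h x l = (SUP v. ereal (q (v - x) x))"
      unfolding moreau_envelope_def ereal_SUP_uminus_eq[symmetric]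
      by (simp add: q_def power2_commute[of x])
    also have "\<dots> = (SUP u. ereal (q u x))"
    proof (rule antisym; rule SUP_least)
      show "ereal (q (v - x) x) \<le> (SUP u. ereal (q u x))" for v by (rule SUP_upper) simp
      show "ereal (q u x) \<le> (SUP v. ereal (q (v - x) x))" for u
        using SUP_upper[of "x + u" UNIV "\<lambda>v. ereal (q (v - x) x)"] by simp
    qed
    finally show ?thesis .
  qed
  have q: "q u (t * x + (1 - t) * y) \<le> t * q u x + (1 - t) * q u y"
    if "0 < t" "t < 1" for t u x y
  proof -
    define A where "A = 1 / (2 * l) * u\<^sup>2"
    have "- h (t *\<^sub>R (x + u) + (1 - t) *\<^sub>R (y + u)) \<le> t * - h (x + u) + (1 - t) * - h (y + u)"
      using convex_onD[OF assms, of "1 - t" "x + u" "y + u"] that by simp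
    moreover have "t *\<^sub>R (x + u) + (1 - t) *\<^sub>R (y + u) = t * x + (1 - t) * y + u"
      by (simp add: algebra_simps)
    ultimately show ?thesis unfolding q_def A_def[symmetric] by (simp add: algebra_simps)
  qed
  show ?thesis
    unfolding ereal_convex_on_def env
  proof (intro conjI allI impI SUP_least)
    fix t x y :: real and u :: real assume t: "0 < t" "t < 1"
    have "ereal (q u (t *\<^sub>R x + (1 - t) *\<^sub>R y)) \<le> ereal t * ereal (q u x) + ereal (1 - t) * ereal (q u y)"
      using q[OF t] by simp
    also have "\<dots> \<le> ereal t * (SUP u. ereal (q u x)) + ereal (1 - t) * (SUP u. ereal (q u y))"
      using t by (intro add_mono ereal_mult_left_mono SUP_upper) auto
    finally show "ereal (q u (t *\<^sub>R x + (1 - t) *\<^sub>R y))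
        \<le> ereal t * (SUP u. ereal (q u x)) + ereal (1 - t) * (SUP u. ereal (q u y))" .
  qed simp
qed

theorem mainTheorem5:
  fixes M :: "'a measure" and G S :: "'a \<Rightarrow> real" and \<delta> :: real
  assumes "prob_space M"
    and "distributed M lborel G (\<lambda>x. ennreal (std_normal_density x))"
    and "distributed M lborel S (\<lambda>x. ennreal (std_normal_density x))"
    and "prob_space.indep_var M borel G borel S"
    and "1 < \<delta>"
  shows "ereal_convex_on UNIV (ell_opt M G S sgn \<delta>)"
proof -
  define \<sigma> where "\<sigma> = sigma_opt M G S sgn \<delta>"
  define \<tau> H I where "\<tau> = 1 + \<sigma>\<^sup>2" and "H = hazard_moment \<sigma>"
    and "I = fisher_information M (W_var G S sgn \<sigma>)"
  define c where "c = 1 / (\<sigma> * sqrt \<tau>)"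
  define \<alpha>1 \<alpha>2 where "\<alpha>1 = alpha1 M G S sgn \<delta>" and "\<alpha>2 = alpha2 M G S sgn \<delta>"
  have \<sigma>: "0 < \<sigma>"
    unfolding \<sigma>_def by (rule prob_space.sigma_opt_pos[OF assms])
  have \<tau>: "0 < \<tau>" by (simp add: \<tau>_def one_plus_square_pos)
  have W: "W_opt M G S sgn \<delta> = W_var G S sgn \<sigma>" by (simp add: W_opt_def \<sigma>_def)
  have dens: "diff_density M (W_opt M G S sgn \<delta>) = W_density \<sigma>"
    unfolding W by (rule prob_space.diff_density_W[OF assms(1-4) \<sigma>])
  have I: "\<tau> * I = 1 + 2 * H / \<sigma>"
    unfolding I_def prob_space.fisher_information_W[OF assms(1-4) \<sigma>] H_def
    using \<tau> by (simp add: \<tau>_def)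
  have D: "\<sigma>\<^sup>2 * I + I - 1 = 2 * H / \<sigma>"
    using I by (simp add: \<tau>_def algebra_simps)
  have D0: "0 \<le> 2 * H / \<sigma>" using \<sigma> by (simp add: H_def hazard_moment_nonneg)
  have \<alpha>: "\<alpha>1 = (1 - \<sigma>\<^sup>2 * I) / (\<delta> * (2 * H / \<sigma>))" "\<alpha>2 = 1 / (\<delta> * (2 * H / \<sigma>))"
    unfolding \<alpha>1_def \<alpha>2_def alpha1_def alpha2_def Let_def W \<sigma>_def[symmetric] I_def[symmetric] D
    by simp_all
  have \<alpha>2: "0 \<le> \<alpha>2" unfolding \<alpha> by (intro divide_nonneg_nonneg mult_nonneg_nonneg D0) (use assms(5) in auto)
  \<comment> \<open>Up to a nonnegative factor this is the inequality \<open>I \<ge> 1 / (1 + \<sigma>\<^sup>2)\<close>.\<close>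
  have quad: "0 \<le> \<alpha>2 / \<tau> - \<alpha>1"
  proof -
    have "1 - \<tau> * (1 - \<sigma>\<^sup>2 * I) = 1 - \<tau> + \<sigma>\<^sup>2 * (\<tau> * I)" by (simp add: algebra_simps)
    also have "\<dots> = \<sigma>\<^sup>2 * (2 * H / \<sigma>)" unfolding I by (simp add: \<tau>_def algebra_simps)
    finally have "0 \<le> 1 - \<tau> * (1 - \<sigma>\<^sup>2 * I)"
      using mult_nonneg_nonneg[OF zero_le_power2[of \<sigma>] D0] by simp
    then have "0 \<le> \<alpha>2 / \<tau> * (1 - \<tau> * (1 - \<sigma>\<^sup>2 * I))"
      using \<alpha>2 \<tau> by (intro mult_nonneg_nonneg divide_nonneg_pos)
    also have "\<dots> = \<alpha>2 / \<tau> - \<alpha>2 * (1 - \<sigma>\<^sup>2 * I)"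
      using \<tau> by (simp add: field_simps)
    also have "\<alpha>2 * (1 - \<sigma>\<^sup>2 * I) = \<alpha>1" by (simp add: \<alpha>)
    finally show ?thesis .
  qed
  define d where "d = 2 / sqrt (2 * pi * \<tau>)"
  have d: "0 < d" using \<tau> by (simp add: d_def)
  have ln_density: "ln (W_density \<sigma> v) = - v\<^sup>2 / (2 * \<tau>) + ln (Phi (c * v)) + ln d" for v
  proof -
    have "W_density \<sigma> v = exp (- v\<^sup>2 / (2 * \<tau>)) * Phi (c * v) * d"
      using \<tau> by (simp add: W_density_def normal_density_def c_def d_def flip: \<tau>_def)
    then show ?thesis
      using Phi_pos[of "c * v"] d by (simp only: ln_mult_pos mult_pos_pos exp_gt_zero ln_exp)
  qed
  have "- (\<alpha>1 * (v\<^sup>2 / 2) + \<alpha>2 * (- v\<^sup>2 / (2 * \<tau>) + L + ln d))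
      = (\<alpha>2 / \<tau> - \<alpha>1) * v\<^sup>2 / 2 - \<alpha>2 * L + - (\<alpha>2 * ln d)" for v L
    using \<tau> by (simp add: algebra_simps diff_divide_distrib)
  then have "(\<lambda>v. - (\<alpha>1 * (v\<^sup>2 / 2) + \<alpha>2 * ln (W_density \<sigma> v)))
      = (\<lambda>v. (\<alpha>2 / \<tau> - \<alpha>1) * v\<^sup>2 / 2 - \<alpha>2 * ln (Phi (c * v)) + - (\<alpha>2 * ln d))"
    unfolding ln_density by (rule ext)
  then have "convex_on UNIV (\<lambda>v. - (\<alpha>1 * (v\<^sup>2 / 2) + \<alpha>2 * ln (W_density \<sigma> v)))"
    by (simp only: convex_quadratic_minus_ln_Phi[OF quad \<alpha>2])
  from ereal_convex_on_minus_moreau_envelope[OF this, of 1]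
  show ?thesis
    unfolding ell_opt_def[abs_def] dens \<alpha>1_def[symmetric] \<alpha>2_def[symmetric] by simp
qed

end
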